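(* Let $0<\varepsilon<1$ and $k,r\in\mathbb{N}$. For any $r$-coloring of $(0,\varepsilon)\cap\mathbb{Q}$ there exist $a$, $b$ and $d$ in $(0,\varepsilon)\cap\mathbb{Q}$ such that the set $\big\{b\cdot(a+i\cdot d)^{j}: i,j\in\{0,1,\ldots,k\}\big\}$ is monochromatic.
   Context: $\mathbb{N}=\{1,2,3,\ldots\}$. An $r$-coloring of a set $X$ is a function $X\to\{1,\ldots,r\}$; a subset is monochromatic if the coloring is constant on it. *)

theory Defs
  imports Complex_Main "HOL-Library.FuncSet"
begin

definition coloring :: "nat \<Rightarrow> 'a set \<Rightarrow> ('a \<Rightarrow> nat) \<Rightarrow> bool" where
  "coloring r X c \<longleftrightarrow> c \<in> X \<rightarrow> {1..r}"

text \<open>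
  A coloring of \<open>X\<close> is a total function that carries no information outside \<open>X\<close>, so
  being monochromatic includes being a subset of \<open>X\<close>.
\<close>

definition monochromatic :: "'a set \<Rightarrow> ('a \<Rightarrow> nat) \<Rightarrow> 'a set \<Rightarrow> bool" where
  "monochromatic X c S \<longleftrightarrow> S \<subseteq> X \<and> (\<exists>m. \<forall>x\<in>S. c x = m)"

end

theory Submission
  imports Defs
begin

text \<open>
  Let \<open>N\<close> be a Hales--Jewett number for the alphabet \<open>{0,\<dots>,k}\<close>. Iterating van der Waerden's
  theorem gives arithmetic progressions \<open>L\<^sub>1,\<dots>,L\<^sub>N\<close> of length \<open>k + 1\<close> such that, for every
  word \<open>w\<close>, the color of \<open>b\<^sub>0 \<Prod>\<^sub>t x\<^sub>t\<^bsup>w t\<^esup>\<close> does not depend on the choice of \<open>x\<^sub>t \<in> L\<^sub>t\<close>.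
  The Hales--Jewett theorem, applied to the coloring of the words \<open>w\<close> so obtained, yields a
  combinatorial line, that is, a monochromatic set of products \<open>b x\<^sup>j\<close>, where \<open>x\<close> is the product of
  the \<open>x\<^sub>t\<close> over the active coordinates and \<open>b\<close> involves only the other coordinates. Now let a
  single active coordinate vary in its progression: \<open>b\<close> stays fixed, no color changes, and \<open>x\<close>
  runs through an arithmetic progression.
\<close>

section \<open>The Hales--Jewett theorem\<close>

definition words :: "'a set \<Rightarrow> nat \<Rightarrow> 'a list set" where
  "words A N = {w. set w \<subseteq> A \<and> length w = N}"

definition instantiate :: "nat option list \<Rightarrow> nat \<Rightarrow> nat list" where
  "instantiate v j = map (case_option j id) v"

text \<open>In a variable word, \<open>None\<close> marks the active coordinates.\<close>

definition variable_word :: "nat \<Rightarrow> nat \<Rightarrow> nat option list \<Rightarrow> bool" where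
  "variable_word n N v \<longleftrightarrow> length v = N \<and> None \<in> set v \<and> (\<forall>m. Some m \<in> set v \<longrightarrow> m < n)"

definition mono_line :: "nat \<Rightarrow> nat \<Rightarrow> (nat list \<Rightarrow> 'c) \<Rightarrow> nat option list \<Rightarrow> bool" where
  "mono_line n N c v \<longleftrightarrow>
    variable_word n N v \<and> (\<forall>i<n. \<forall>j<n. c (instantiate v i) = c (instantiate v j))"

definition hales_jewett_number :: "nat \<Rightarrow> nat \<Rightarrow> nat \<Rightarrow> bool" where
  "hales_jewett_number n r N \<longleftrightarrow>
    (\<forall>c :: nat list \<Rightarrow> nat. c \<in> words {..<n} N \<rightarrow> {..<r} \<longrightarrow> (\<exists>v. mono_line n N c v))"

section \<open>Closure properties of words and variable words\<close>

lemma finite_words: "finite A \<Longrightarrow> finite (words A N)"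
  unfolding words_def by (rule finite_lists_length_eq)

lemma nth_in_words: "w \<in> words A N \<Longrightarrow> t < N \<Longrightarrow> w ! t \<in> A"
  using nth_mem by (fastforce simp: words_def)

lemma append_in_words: "u \<in> words A M \<Longrightarrow> w \<in> words A N \<Longrightarrow> u @ w \<in> words A (M + N)"
  by (auto simp: words_def)

lemma words_mono: "A \<subseteq> B \<Longrightarrow> words A N \<subseteq> words B N"
  by (auto simp: words_def)

lemma length_instantiate [simp]: "length (instantiate v j) = length v"
  by (simp add: instantiate_def)

lemma instantiate_append: "instantiate (u @ v) j = instantiate u j @ instantiate v j"
  by (simp add: instantiate_def)

lemma instantiate_constant [simp]: "instantiate (map Some w) j = w"
  by (induction w) (auto simp: instantiate_def)

lemma instantiate_in_words:
  "variable_word n N v \<Longrightarrow> n \<le> m \<Longrightarrow> j < m \<Longrightarrow> instantiate v j \<in> words {..<m} N"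
  by (fastforce simp: variable_word_def words_def instantiate_def split: option.splits)

lemma variable_word_append:
  "variable_word n M u \<Longrightarrow> variable_word n N v \<Longrightarrow> variable_word n (M + N) (u @ v)"
  by (auto simp: variable_word_def)

lemma variable_word_append_constant:
  "variable_word n M u \<Longrightarrow> w \<in> words {..<n} N \<Longrightarrow> variable_word n (M + N) (u @ map Some w)"
  by (auto simp: variable_word_def words_def)

lemma variable_word_constant_append:
  "w \<in> words {..<n} M \<Longrightarrow> variable_word n N v \<Longrightarrow> variable_word n (M + N) (map Some w @ v)"
  by (auto simp: variable_word_def words_def)

lemma variable_word_mono: "variable_word n N v \<Longrightarrow> n \<le> m \<Longrightarrow> variable_word m N v"
  by (auto simp: variable_word_def intro: less_le_trans)

text \<open>Renaming the colors along a bijection of \<open>K\<close> with an initial segment of the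
  naturals. This is what allows product colorings, whose colors are themselves lists of
  colors.\<close>

lemma hales_jewett_number_finite_colors:
  assumes hj: "hales_jewett_number n (card K) N"
    and "finite K" and c: "c \<in> words {..<n} N \<rightarrow> K"
  obtains v where "mono_line n N c v"
proof -
  obtain h where h: "bij_betw h K {..<card K}"
    using ex_bij_betw_finite_nat[OF \<open>finite K\<close>] by (auto simp: atLeast0LessThan)
  have "h \<circ> c \<in> words {..<n} N \<rightarrow> {..<card K}"
    using h c by (force simp: bij_betw_def)
  then obtain v where v: "mono_line n N (h \<circ> c) v"
    using hj unfolding hales_jewett_number_def by blast
  have "c (instantiate v i) = c (instantiate v j)" if "i < n" "j < n" for i j
  proof -
    have "instantiate v i \<in> words {..<n} N" "instantiate v j \<in> words {..<n} N"
      using v that unfolding mono_line_def by (blast intro: instantiate_in_words)+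
    then have "c (instantiate v i) \<in> K" "c (instantiate v j) \<in> K"
      using c by auto
    moreover have "h (c (instantiate v i)) = h (c (instantiate v j))"
      using v that unfolding mono_line_def comp_def by blast
    ultimately show ?thesis
      using bij_betw_imp_inj_on[OF h] by (auto dest: inj_onD)
  qed
  then have "mono_line n N c v"
    using v unfolding mono_line_def by blast
  then show thesis by (rule that)
qed

section \<open>Color focusing\<close>

definition color_focused ::
  "nat \<Rightarrow> nat \<Rightarrow> (nat list \<Rightarrow> nat) \<Rightarrow> nat list \<Rightarrow> nat option list list \<Rightarrow> bool" where
  "color_focused n N c f vs \<longleftrightarrow>
    f \<in> words {..<Suc n} N \<and>
    (\<forall>v\<in>set vs. variable_word (Suc n) N v \<and> instantiate v n = f \<and>
      (\<forall>j<n. c (instantiate v j) = c (instantiate v 0))) \<and>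
    distinct (map (\<lambda>v. c (instantiate v 0)) vs)"

text \<open>The induction step from \<open>n\<close> to \<open>n + 1\<close> letters. The color of
  the focus is left open: if it equals the color of a focused line, that line is monochromatic over
  all \<open>n + 1\<close> letters; otherwise the focus supplies the color of one more line. Hence
  the induction on the number \<open>s\<close> of lines.\<close>

lemma color_focused_lines_exist:
  assumes hj: "\<And>r. \<exists>N. hales_jewett_number n r N" and n: "0 < n"
  shows "\<exists>N. \<forall>c \<in> words {..<Suc n} N \<rightarrow> {..<r}.
    (\<exists>v. mono_line (Suc n) N c v) \<or> (\<exists>f vs. color_focused n N c f vs \<and> length vs = s)"
proof (induction s)
  case 0
  have "color_focused n 0 c [] []" for c
    by (auto simp: color_focused_def words_def)
  then show ?case by (intro exI[of _ 0]) blast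
next
  case (Suc s)
  then obtain N where N: "\<And>c. c \<in> words {..<Suc n} N \<rightarrow> {..<r} \<Longrightarrow>
      (\<exists>v. mono_line (Suc n) N c v) \<or> (\<exists>f vs. color_focused n N c f vs \<and> length vs = s)"
    by blast
  obtain ws where ws: "set ws = words {..<Suc n} N"
    using finite_list[OF finite_words[of "{..<Suc n}"]] by blast
  \<comment> \<open>A color in \<open>K\<close> is a whole coloring of the suffixes of length
    \<open>N\<close>, read along the enumeration \<open>ws\<close>. The block length
    \<open>M\<close> is thus chosen after \<open>N\<close>.\<close>
  define K where "K = words {..<r} (length ws)"
  obtain M where M: "hales_jewett_number n (card K) M"
    using hj by blast
  show ?case
  proof (intro exI[of _ "M + N"] ballI)
    fix c assume c: "c \<in> words {..<Suc n} (M + N) \<rightarrow> {..<r}"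
    define C where "C u = map (\<lambda>w. c (u @ w)) ws" for u
    have "C \<in> words {..<n} M \<rightarrow> K"
    proof
      fix u assume "u \<in> words {..<n} M"
      then have "u \<in> words {..<Suc n} M"
        using words_mono[of "{..<n}" "{..<Suc n}"] by auto
      then have "c (u @ w) < r" if "w \<in> set ws" for w
        using that c append_in_words[of u "{..<Suc n}" M w N] by (auto simp: ws)
      then show "C u \<in> K" by (auto simp: C_def K_def words_def)
    qed
    then obtain U where U: "mono_line n M C U"
      using hales_jewett_number_finite_colors[OF M] finite_words[of "{..<r}"]
      unfolding K_def by blast
    define U0 where "U0 = instantiate U 0"
    have U_var: "variable_word (Suc n) M U"
      using U by (auto simp: mono_line_def intro: variable_word_mono)
    have U0: "U0 \<in> words {..<Suc n} M"
      unfolding U0_def using U_var by (rule instantiate_in_words) auto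
    \<comment> \<open>The line \<open>U\<close> was found over the alphabet of size
      \<open>n\<close>, so nothing is known at the letter \<open>n\<close>; that point becomes part
      of the new focus.\<close>
    have U_const: "c (instantiate U j @ w) = c (U0 @ w)"
      if "j < n" "w \<in> words {..<Suc n} N" for j w
    proof -
      have "C (instantiate U j) = C U0"
        using U that(1) n unfolding mono_line_def U0_def by blast
      then show ?thesis using that(2) unfolding C_def map_eq_conv ws by blast
    qed
    define c' where "c' w = c (U0 @ w)" for w
    have "c' \<in> words {..<Suc n} N \<rightarrow> {..<r}"
      using c append_in_words[OF U0] by (auto simp: c'_def)
    from N[OF this]
    show "(\<exists>v. mono_line (Suc n) (M + N) c v) \<or>
      (\<exists>f vs. color_focused n (M + N) c f vs \<and> length vs = Suc s)"
    proof
      assume "\<exists>v. mono_line (Suc n) N c' v"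
      then obtain v where "mono_line (Suc n) N c' v" by blast
      then have "mono_line (Suc n) (M + N) c (map Some U0 @ v)"
        using U0 variable_word_constant_append
        unfolding mono_line_def c'_def instantiate_append instantiate_constant by blast
      then show ?thesis by blast
    next
      assume "\<exists>f vs. color_focused n N c' f vs \<and> length vs = s"
      then obtain f vs where foc: "color_focused n N c' f vs" and len: "length vs = s"
        by blast
      have f: "f \<in> words {..<Suc n} N"
        and var: "\<And>v. v \<in> set vs \<Longrightarrow> variable_word (Suc n) N v"
        and focus: "\<And>v. v \<in> set vs \<Longrightarrow> instantiate v n = f"
        and const: "\<And>v j. v \<in> set vs \<Longrightarrow> j < n \<Longrightarrow> c' (instantiate v j) = c' (instantiate v 0)"
        and dist: "distinct (map (\<lambda>v. c' (instantiate v 0)) vs)"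
        using foc unfolding color_focused_def by blast+
      show ?thesis
      proof (cases "\<exists>v\<in>set vs. c' (instantiate v 0) = c' f")
        case True
        then obtain v where v: "v \<in> set vs" and eq: "c' (instantiate v 0) = c' f" by blast
        have "c' (instantiate v j) = c' f" if "j < Suc n" for j
          using focus const v eq that by (metis less_SucE)
        then have "c' (instantiate v i) = c' (instantiate v j)" if "i < Suc n" "j < Suc n" for i j
          using that by metis
        moreover have "variable_word (Suc n) (M + N) (map Some U0 @ v)"
          using U0 var[OF v] by (rule variable_word_constant_append)
        ultimately have "mono_line (Suc n) (M + N) c (map Some U0 @ v)"
          unfolding mono_line_def c'_def instantiate_append instantiate_constant by blast
        then show ?thesis by blast
      next
        case False
        \<comment> \<open>The old lines now move in both blocks at once and keep their colors, while
          the new line moves in the prefix only and has the color of \<open>f\<close>, which by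
          \<open>False\<close> is a new one. At the letter \<open>n\<close> all of them reach
          \<open>instantiate U n @ f\<close>.\<close>
        define vs' where "vs' = (U @ map Some f) # map (\<lambda>v. U @ v) vs"
        have vs'_cases: thesis
          if "v \<in> set vs'" "v = U @ map Some f \<Longrightarrow> thesis"
            "\<And>v'. v' \<in> set vs \<Longrightarrow> v = U @ v' \<Longrightarrow> thesis" for v thesis
          using that by (auto simp: vs'_def)
        have zero: "c (instantiate (U @ v) 0) = c' (instantiate v 0)" for v
          by (simp add: instantiate_append c'_def U0_def)
        have line: "c (instantiate (U @ v) j) = c' (instantiate v j)"
          if "v \<in> set vs" "j < n" for v j
        proof -
          have "instantiate v j \<in> words {..<Suc n} N"
            using var that by (intro instantiate_in_words) auto
          then show ?thesis
            using U_const that by (simp add: instantiate_append c'_def)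
        qed
        have "color_focused n (M + N) c (instantiate U n @ f) vs'"
          unfolding color_focused_def
        proof (intro conjI ballI)
          show "instantiate U n @ f \<in> words {..<Suc n} (M + N)"
            using instantiate_in_words[OF U_var] f by (intro append_in_words) auto
          show "distinct (map (\<lambda>v. c (instantiate v 0)) vs')"
            using dist False by (auto simp: vs'_def zero comp_def)
        next
          fix v assume "v \<in> set vs'"
          then show "variable_word (Suc n) (M + N) v"
            by (rule vs'_cases) (use U_var f var in
                \<open>auto intro: variable_word_append variable_word_append_constant\<close>)
        next
          fix v assume "v \<in> set vs'"
          then show "instantiate v n = instantiate U n @ f"
            by (rule vs'_cases) (simp_all add: instantiate_append focus)
        next
          fix v assume "v \<in> set vs'"
          then show "\<forall>j<n. c (instantiate v j) = c (instantiate v 0)"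
          proof (rule vs'_cases)
            assume v: "v = U @ map Some f"
            show ?thesis
              using U_const[OF _ f] n unfolding v instantiate_append instantiate_constant by metis
          next
            fix v' assume "v' \<in> set vs" "v = U @ v'"
            then show ?thesis using line const n by metis
          qed
        qed
        moreover have "length vs' = Suc s" by (simp add: vs'_def len)
        ultimately show ?thesis by blast
      qed
    qed
  qed
qed

text \<open>Induction on the alphabet, for all \<open>r\<close> at once because focusing invokes the
  smaller alphabet with many more colors. Focused lines with \<open>r + 1\<close> different colors
  contradict the pigeonhole principle, so a monochromatic line remains.\<close>

theorem hales_jewett: "\<exists>N. hales_jewett_number n r N"
proof (induction n arbitrary: r)
  case 0
  have "mono_line 0 1 c [None]" for c :: "nat list \<Rightarrow> nat"
    by (auto simp: mono_line_def variable_word_def)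
  then show ?case unfolding hales_jewett_number_def by blast
next
  case (Suc n)
  show ?case
  proof (cases "n = 0")
    case True
    \<comment> \<open>Focused lines are compared at the letter \<open>0\<close>, which must lie
      below \<open>n\<close>. The one-letter alphabet is therefore treated apart; its lines have a
      single point.\<close>
    have "mono_line 1 1 c [None]" for c :: "nat list \<Rightarrow> nat"
      by (auto simp: mono_line_def variable_word_def)
    then show ?thesis using True unfolding hales_jewett_number_def by fastforce
  next
    case False
    then obtain N where N: "\<And>c. c \<in> words {..<Suc n} N \<rightarrow> {..<r} \<Longrightarrow>
        (\<exists>v. mono_line (Suc n) N c v) \<or> (\<exists>f vs. color_focused n N c f vs \<and> length vs = Suc r)"
      using color_focused_lines_exist[of n r "Suc r"] Suc.IH by blast
    have "\<exists>v. mono_line (Suc n) N c v" if c: "c \<in> words {..<Suc n} N \<rightarrow> {..<r}" for c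
    proof (rule ccontr)
      assume "\<nexists>v. mono_line (Suc n) N c v"
      then obtain f vs where foc: "color_focused n N c f vs" and len: "length vs = Suc r"
        using N[OF c] by blast
      let ?cs = "map (\<lambda>v. c (instantiate v 0)) vs"
      have "set ?cs \<subseteq> {..<r}"
      proof
        fix x assume "x \<in> set ?cs"
        then obtain v where "v \<in> set vs" "x = c (instantiate v 0)" by auto
        moreover from this have "instantiate v 0 \<in> words {..<Suc n} N"
          using foc by (auto simp: color_focused_def intro: instantiate_in_words)
        ultimately show "x \<in> {..<r}" using c by auto
      qed
      then have "card (set ?cs) \<le> r"
        using card_mono[of "{..<r}"] by fastforce
      moreover have "card (set ?cs) = Suc r"
        using foc len distinct_card[of ?cs] by (simp add: color_focused_def)
      ultimately show False by simp
    qed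
    then show ?thesis unfolding hales_jewett_number_def by blast
  qed
qed

section \<open>Grids of arithmetic progressions\<close>

lemma sum_list_instantiate:
  "sum_list (instantiate v j) = sum_list (instantiate v 0) + j * count_list v None"
  by (induction v) (auto simp: instantiate_def split: option.splits)

lemma sum_list_words_le: "w \<in> words {..<Suc k} N \<Longrightarrow> sum_list w \<le> k * N"
proof -
  assume w: "w \<in> words {..<Suc k} N"
  then have "sum_list w \<le> sum_list (map (\<lambda>_. k) w)"
    using sum_list_mono[of w "\<lambda>x. x" "\<lambda>_. k"] by (fastforce simp: words_def)
  then show ?thesis using w by (simp add: words_def sum_list_triv mult.commute)
qed

text \<open>Coloring a word by the color of one plus its letter sum turns a combinatorial line into
  an arithmetic progression. Its difference is the number of active coordinates, hence
  positive.\<close>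

theorem van_der_Waerden:
  fixes K :: "'c set" and k :: nat
  assumes "finite K"
  shows "\<exists>W. \<forall>c \<in> {1..W} \<rightarrow> K. \<exists>a d. 1 \<le> a \<and> 1 \<le> d \<and> a + k * d \<le> W \<and>
    (\<forall>i\<le>k. c (a + i * d) = c a)"
proof -
  obtain N where N: "hales_jewett_number (Suc k) (card K) N"
    using hales_jewett by blast
  show ?thesis
  proof (rule exI[of _ "1 + k * N"], rule ballI)
    fix c assume c: "c \<in> {1..1 + k * N} \<rightarrow> K"
    have "(\<lambda>w. c (1 + sum_list w)) \<in> words {..<Suc k} N \<rightarrow> K"
      using c sum_list_words_le by fastforce
    then obtain v where v: "mono_line (Suc k) N (\<lambda>w. c (1 + sum_list w)) v"
      using hales_jewett_number_finite_colors[OF N \<open>finite K\<close>] by blast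
    define a where "a = 1 + sum_list (instantiate v 0)"
    define d where "d = count_list v None"
    have sum: "1 + sum_list (instantiate v i) = a + i * d" for i
      by (subst sum_list_instantiate) (simp add: a_def d_def)
    have "1 \<le> d"
      using v count_list_0_iff[of v None]
      by (auto simp: d_def mono_line_def variable_word_def Suc_le_eq)
    moreover have "a + k * d \<le> 1 + k * N"
    proof -
      have "instantiate v k \<in> words {..<Suc k} N"
        using v by (auto simp: mono_line_def intro: instantiate_in_words)
      then show ?thesis using sum_list_words_le[of "instantiate v k" k N] sum[of k] by simp
    qed
    moreover have "c (a + i * d) = c a" if "i \<le> k" for i
    proof -
      have "c (1 + sum_list (instantiate v i)) = c (1 + sum_list (instantiate v 0))"
        using v that unfolding mono_line_def by simp
      then show ?thesis unfolding sum by simp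
    qed
    ultimately show "\<exists>a d. 1 \<le> a \<and> 1 \<le> d \<and> a + k * d \<le> 1 + k * N \<and>
        (\<forall>i\<le>k. c (a + i * d) = c a)"
      unfolding a_def by (metis le_add1)
  qed
qed

text \<open>Only one coordinate at a time leaves the base point \<open>as\<close>, which is all that
  the final argument uses. The bound by \<open>W\<close> keeps each progression inside the colored
  range.\<close>

lemma mono_grid:
  fixes K :: "'c set" and k N :: nat
  assumes "finite K"
  shows "\<exists>W. \<forall>c \<in> words {1..W} N \<rightarrow> K. \<exists>as ds. as \<in> words {1..W} N \<and> length ds = N \<and>
    (\<forall>t<N. 1 \<le> ds ! t \<and> as ! t + k * ds ! t \<le> W \<and>
      (\<forall>i\<le>k. c (as[t := as ! t + i * ds ! t]) = c as))"
proof (induction N)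
  case 0
  show ?case by (auto simp: words_def)
next
  case (Suc N)
  then obtain W where W: "\<And>c. c \<in> words {1..W} N \<rightarrow> K \<Longrightarrow>
    \<exists>as ds. as \<in> words {1..W} N \<and> length ds = N \<and>
    (\<forall>t<N. 1 \<le> ds ! t \<and> as ! t + k * ds ! t \<le> W \<and>
      (\<forall>i\<le>k. c (as[t := as ! t + i * ds ! t]) = c as))"
    by blast
  obtain xss where xss: "set xss = words {1..W} N"
    using finite_list[OF finite_words[of "{1..W}"]] by blast
  define L where "L = words K (length xss)"
  have "finite L" unfolding L_def using \<open>finite K\<close> by (rule finite_words)
  obtain V where V: "\<And>c. c \<in> {1..V} \<rightarrow> L \<Longrightarrow> \<exists>a d. 1 \<le> a \<and> 1 \<le> d \<and> a + k * d \<le> V \<and>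
    (\<forall>i\<le>k. c (a + i * d) = c a)"
    using van_der_Waerden[OF \<open>finite L\<close>, of k] by blast
  show ?case
  proof (rule exI[of _ "max V W"], rule ballI)
    fix c assume c: "c \<in> words {1..max V W} (Suc N) \<rightarrow> K"
    have cK: "c (x # xs) \<in> K" if "x \<in> {1..V}" "xs \<in> words {1..W} N" for x xs
    proof -
      have "x # xs \<in> words {1..max V W} (Suc N)"
        using that by (fastforce simp: words_def)
      then show ?thesis using c by blast
    qed
    define C where "C x = map (\<lambda>xs. c (x # xs)) xss" for x
    have "C \<in> {1..V} \<rightarrow> L"
      using cK by (auto simp: C_def L_def words_def xss[unfolded words_def])
    then obtain a d where a: "1 \<le> a" and d: "1 \<le> d" and ad: "a + k * d \<le> V"
      and C: "\<And>i. i \<le> k \<Longrightarrow> C (a + i * d) = C a"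
      using V by blast
    \<comment> \<open>This holds for every tail \<open>xs\<close>, since \<open>C\<close> records
      all tails. The first progression can therefore be fixed before the induction hypothesis
      selects the tail.\<close>
    have first: "c ((a + i * d) # xs) = c (a # xs)" if "i \<le> k" "xs \<in> words {1..W} N" for i xs
      using C[OF that(1)] that(2) unfolding C_def map_eq_conv xss by blast
    have "(\<lambda>xs. c (a # xs)) \<in> words {1..W} N \<rightarrow> K"
      using cK a ad by auto
    from W[OF this] obtain as ds where as: "as \<in> words {1..W} N" and ds: "length ds = N"
      and grid: "\<And>t. t < N \<Longrightarrow> 1 \<le> ds ! t \<and> as ! t + k * ds ! t \<le> W \<and>
        (\<forall>i\<le>k. c (a # as[t := as ! t + i * ds ! t]) = c (a # as))"
      by blast
    show "\<exists>as ds. as \<in> words {1..max V W} (Suc N) \<and> length ds = Suc N \<and>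
      (\<forall>t<Suc N. 1 \<le> ds ! t \<and> as ! t + k * ds ! t \<le> max V W \<and>
        (\<forall>i\<le>k. c (as[t := as ! t + i * ds ! t]) = c as))"
    proof (rule exI[of _ "a # as"], rule exI[of _ "d # ds"], intro conjI allI impI)
      show "a # as \<in> words {1..max V W} (Suc N)"
        using as a ad by (fastforce simp: words_def)
      show "length (d # ds) = Suc N" using ds by simp
      fix t assume t: "t < Suc N"
      show "1 \<le> (d # ds) ! t"
        using t d grid by (cases t) auto
      show "(a # as) ! t + k * (d # ds) ! t \<le> max V W"
        using t ad grid by (cases t) (auto simp: le_max_iff_disj)
      fix i assume "i \<le> k"
      then show "c ((a # as)[t := (a # as) ! t + i * (d # ds) ! t]) = c (a # as)"
        using t grid first[OF _ as] by (cases t) auto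
    qed
  qed
qed

section \<open>Geo-arithmetic progressions\<close>

text \<open>A combinatorial line becomes a geometric progression in \<open>j\<close>: the fixed
  coordinates give the constant factor, the active ones the common ratio.\<close>

lemma prod_instantiate:
  fixes y :: "nat \<Rightarrow> 'a :: comm_semiring_1"
  assumes "length v = N"
  shows "(\<Prod>t<N. y t ^ (instantiate v j ! t)) =
    (\<Prod>t\<in>{t. t < N \<and> v ! t \<noteq> None}. y t ^ the (v ! t)) * (\<Prod>t\<in>{t. t < N \<and> v ! t = None}. y t) ^ j"
proof -
  let ?S = "{t. t < N \<and> v ! t = None}" and ?F = "{t. t < N \<and> v ! t \<noteq> None}"
  have "{..<N} = ?F \<union> ?S" by auto
  then have "(\<Prod>t<N. y t ^ (instantiate v j ! t)) = (\<Prod>t\<in>?F \<union> ?S. y t ^ (instantiate v j ! t))"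
    by simp
  also have "\<dots> = (\<Prod>t\<in>?F. y t ^ (instantiate v j ! t)) * (\<Prod>t\<in>?S. y t ^ (instantiate v j ! t))"
    by (rule prod.union_disjoint) auto
  also have "(\<Prod>t\<in>?F. y t ^ (instantiate v j ! t)) = (\<Prod>t\<in>?F. y t ^ the (v ! t))"
    by (rule prod.cong) (auto simp: instantiate_def assms)
  also have "(\<Prod>t\<in>?S. y t ^ (instantiate v j ! t)) = (\<Prod>t\<in>?S. y t ^ j)"
    by (rule prod.cong) (auto simp: instantiate_def assms)
  also have "\<dots> = (\<Prod>t\<in>?S. y t) ^ j" by (simp add: prod_power_distrib)
  finally show ?thesis .
qed

theorem theorem2:
  fixes \<epsilon> :: real and k r :: nat and c :: "real \<Rightarrow> nat"
  assumes "0 < \<epsilon>" and "\<epsilon> < 1"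
    and "1 \<le> k" and "1 \<le> r"
    and "coloring r ({0<..<\<epsilon>} \<inter> \<rat>) c"
  shows "\<exists>a \<in> {0<..<\<epsilon>} \<inter> \<rat>. \<exists>b \<in> {0<..<\<epsilon>} \<inter> \<rat>. \<exists>d \<in> {0<..<\<epsilon>} \<inter> \<rat>.
    monochromatic ({0<..<\<epsilon>} \<inter> \<rat>) c
      {b * (a + real i * d) ^ j | i j. i \<in> {0..k} \<and> j \<in> {0..k}}"
proof -
  let ?X = "{0<..<\<epsilon>} \<inter> \<rat>" and ?A = "{..<Suc k}"
  have c: "c x \<in> {1..r}" if "x \<in> ?X" for x
    using assms(5) that by (auto simp: coloring_def)
  have mult_X: "x * z \<in> ?X" if "x \<in> ?X" "0 < z" "z \<le> 1" "z \<in> \<rat>" for x z :: real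
  proof -
    have "x * z \<le> x" using that by (intro mult_left_le) auto
    also have "x < \<epsilon>" using that by auto
    finally show ?thesis using that by auto
  qed
  obtain N where N: "hales_jewett_number (Suc k) (card {1..r}) N"
    using hales_jewett by blast
  obtain ws where ws: "set ws = words ?A N"
    using finite_list[OF finite_words[of ?A]] by blast
  define K where "K = words {1..r} (length ws)"
  have "finite K" unfolding K_def by (intro finite_words) simp
  from mono_grid[OF this, where N = N and k = k]
  obtain W where W: "\<And>C. C \<in> words {1..W} N \<rightarrow> K \<Longrightarrow>
    \<exists>as ds. as \<in> words {1..W} N \<and> length ds = N \<and>
    (\<forall>t<N. 1 \<le> ds ! t \<and> as ! t + k * ds ! t \<le> W \<and>
      (\<forall>i\<le>k. C (as[t := as ! t + i * ds ! t]) = C as))"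
    by blast
  \<comment> \<open>Scaling by \<open>\<delta>\<close> carries \<open>{1..W}\<close> into the
    colored interval and preserves arithmetic progressions. The denominator \<open>W + 1\<close> is
    positive even for \<open>W = 0\<close>.\<close>
  obtain \<delta> :: real where "\<delta> \<in> \<rat>" "0 < \<delta>" and \<delta>': "\<delta> < \<epsilon> / (real W + 1)"
    using Rats_dense_in_real[of 0 "\<epsilon> / (real W + 1)"] assms(1) by auto
  have \<delta>: "real m * \<delta> \<in> ?X" if "m \<in> {1..W}" for m
  proof -
    have "real m * \<delta> \<le> (real W + 1) * \<delta>"
      using that \<open>0 < \<delta>\<close> by (intro mult_right_mono) auto
    also have "\<dots> < \<epsilon>" using \<delta>' by (simp add: field_simps)
    finally show ?thesis using that \<open>0 < \<delta>\<close> \<open>\<delta> \<in> \<rat>\<close> by auto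
  qed
  \<comment> \<open>A product that is empty or has only zero exponents equals 1, which lies outside
    the interval. The factor \<open>b0\<close> keeps \<open>P\<close> and \<open>b\<close> inside
    it.\<close>
  obtain b0 :: real where b0: "b0 \<in> ?X"
    using Rats_dense_in_real[of 0 \<epsilon>] assms(1) by auto
  define y where "y xs t = real (xs ! t) * \<delta>" for xs :: "nat list" and t
  have y: "y xs t \<in> ?X" if "xs \<in> words {1..W} N" "t < N" for xs t
    unfolding y_def using that by (intro \<delta> nth_in_words)
  have prod_unit: "0 < (\<Prod>t\<in>T. f t) \<and> (\<Prod>t\<in>T. f t) \<le> 1 \<and> (\<Prod>t\<in>T. f t) \<in> \<rat>"
    if "\<And>t. t \<in> T \<Longrightarrow> 0 < f t \<and> f t \<le> 1 \<and> f t \<in> \<rat>" for T :: "nat set" and f :: "nat \<Rightarrow> real"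
    using that by (meson less_imp_le prod_le_1 prod_pos Rats_prod)
  have power_unit: "0 < z ^ m \<and> z ^ m \<le> 1 \<and> z ^ m \<in> \<rat>" if "z \<in> ?X" for z :: real and m
    using that assms(2) by (auto intro: power_le_one)
  define P where "P w xs = b0 * (\<Prod>t<N. y xs t ^ (w ! t))" for w xs
  have P: "P w xs \<in> ?X" if "xs \<in> words {1..W} N" for w xs
    unfolding P_def using prod_unit[of "{..<N}" "\<lambda>t. y xs t ^ (w ! t)"] power_unit y[OF that]
    by (intro mult_X[OF b0]) auto
  \<comment> \<open>Recording the colors for all words together yields progressions that serve
    whichever line \<open>v\<close> is found later.\<close>
  define C where "C xs = map (\<lambda>w. c (P w xs)) ws" for xs
  have "C \<in> words {1..W} N \<rightarrow> K"
    using c P by (auto simp: C_def K_def words_def)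
  from W[OF this] obtain as ds where as: "as \<in> words {1..W} N" and "length ds = N"
    and grid: "\<And>t. t < N \<Longrightarrow> 1 \<le> ds ! t \<and> as ! t + k * ds ! t \<le> W \<and>
      (\<forall>i\<le>k. C (as[t := as ! t + i * ds ! t]) = C as)"
    by blast
  have "(\<lambda>w. c (P w as)) \<in> words ?A N \<rightarrow> {1..r}"
    using c P[OF as] by blast
  then obtain v where v: "mono_line (Suc k) N (\<lambda>w. c (P w as)) v"
    using hales_jewett_number_finite_colors[OF N] by blast
  then have v_len: "length v = N" and "None \<in> set v"
    by (auto simp: mono_line_def variable_word_def)
  then obtain s where s: "s < N" "v ! s = None"
    by (auto simp: in_set_conv_nth)
  let ?S = "{t. t < N \<and> v ! t = None}" and ?F = "{t. t < N \<and> v ! t \<noteq> None}"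
  define b where "b = b0 * (\<Prod>t\<in>?F. y as t ^ the (v ! t))"
  \<comment> \<open>The active coordinates other than \<open>s\<close> stay at their base points.
    Their product \<open>q\<close> rescales the progression at \<open>s\<close> to the one with
    start \<open>a\<close> and difference \<open>d\<close>.\<close>
  define q where "q = (\<Prod>t\<in>?S - {s}. y as t)"
  define a where "a = real (as ! s) * \<delta> * q"
  define d where "d = real (ds ! s) * \<delta> * q"
  have as_len: "length as = N" using as by (simp add: words_def)
  have P_line: "P (instantiate v j) (as[s := as ! s + i * ds ! s]) = b * (a + real i * d) ^ j" for i j
  proof -
    let ?xs = "as[s := as ! s + i * ds ! s]"
    have y_other: "y ?xs t = y as t" if "t \<noteq> s" for t
      using that by (simp add: y_def)
    \<comment> \<open>Since \<open>s\<close> is active, it does not occur in \<open>?F\<close>, and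
      so moving it leaves \<open>b\<close> unchanged.\<close>
    have "(\<Prod>t\<in>?F. y ?xs t ^ the (v ! t)) = (\<Prod>t\<in>?F. y as t ^ the (v ! t))"
      using s by (intro prod.cong refl) (metis (mono_tags, lifting) y_other mem_Collect_eq)
    moreover have "(\<Prod>t\<in>?S. y ?xs t) = y ?xs s * (\<Prod>t\<in>?S - {s}. y ?xs t)"
      using s by (intro prod.remove) auto
    moreover have "(\<Prod>t\<in>?S - {s}. y ?xs t) = q"
      unfolding q_def by (intro prod.cong refl y_other) blast
    moreover have "y ?xs s * q = a + real i * d"
      using s as_len by (simp add: y_def a_def d_def algebra_simps)
    ultimately show ?thesis
      unfolding P_def b_def prod_instantiate[OF v_len] by (simp add: mult.assoc)
  qed
  have shift: "as[s := as ! s + i * ds ! s] \<in> words {1..W} N" if "i \<le> k" for i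
  proof -
    have "as ! s + i * ds ! s \<le> W"
      using grid[OF s(1)] that mult_right_mono[of i k "ds ! s"] by linarith
    moreover have "1 \<le> as ! s" using nth_in_words[OF as s(1)] by simp
    ultimately show ?thesis
      using as set_update_subset_insert[of as s] by (fastforce simp: words_def)
  qed
  \<comment> \<open>First the grid moves coordinate \<open>s\<close> back to its base point with the
    word fixed; then the line \<open>v\<close> replaces \<open>j\<close> by
    \<open>0\<close>.\<close>
  have const: "c (b * (a + real i * d) ^ j) = c (P (instantiate v 0) as)"
    if "i \<le> k" "j \<le> k" for i j
  proof -
    have "instantiate v j \<in> set ws"
      using v that by (auto simp: ws mono_line_def intro: instantiate_in_words)
    moreover have "C (as[s := as ! s + i * ds ! s]) = C as"
      using grid s that by blast
    ultimately have "c (P (instantiate v j) (as[s := as ! s + i * ds ! s])) = c (P (instantiate v j) as)"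
      by (auto simp: C_def)
    also have "\<dots> = c (P (instantiate v 0) as)"
      using v that by (auto simp: mono_line_def)
    finally show ?thesis by (simp add: P_line)
  qed
  have "b \<in> ?X"
    unfolding b_def using prod_unit[of ?F "\<lambda>t. y as t ^ the (v ! t)"] power_unit y[OF as]
    by (intro mult_X[OF b0]) auto
  moreover have q: "0 < q \<and> q \<le> 1 \<and> q \<in> \<rat>"
    unfolding q_def using y[OF as] assms(2) by (intro prod_unit) fastforce
  then have "a \<in> ?X"
    unfolding a_def using nth_in_words[OF as s(1)] by (intro mult_X \<delta>) auto
  moreover have "d \<in> ?X"
  proof -
    \<comment> \<open>Here \<open>1 \<le> k\<close> enters: the bound on the last term of the
      progression then also bounds its difference by \<open>W\<close>.\<close>
    have "ds ! s \<le> k * ds ! s" using assms(3) by simp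
    then have "ds ! s \<in> {1..W}"
      using grid[OF s(1)] unfolding atLeastAtMost_iff by linarith
    then show ?thesis unfolding d_def using q by (intro mult_X \<delta>) auto
  qed
  moreover have "monochromatic ?X c {b * (a + real i * d) ^ j | i j. i \<in> {0..k} \<and> j \<in> {0..k}}"
  proof -
    have "b * (a + real i * d) ^ j \<in> ?X" if "i \<le> k" for i j
      using P[OF shift[OF that]] P_line by metis
    then show ?thesis unfolding monochromatic_def using const by fastforce
  qed
  ultimately show ?thesis by blast
qed

end
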